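(* In the critical regime $\theta\sim\frac1n$, the size $K$ of the largest simplex in the Vietoris-Rips complex based on a binomial point process of $n$ points on the torus $\mathbb{T}^d_a$ grows asymptotically almost surely slower than $\ln n$ with an arbitrarily small distance; that is, for every real $\eta>0$, asymptotically almost surely as $n\to\infty$, $$(\ln n)^{1-\eta}<K<\ln n.$$
   Context: $\mathbb{T}^d_a$ is the $d$-dimensional torus of side $a$, with the distance induced by the uniform norm $\|x\|_\infty=\max_i|x_i|$. A binomial point process of $n$ points is a set of $n$ independent uniformly distributed points on $\mathbb{T}^d_a$. The Vietoris-Rips complex on these points is the abstract simplicial complex whose $k$-simplices are the sets of $k+1$ points that are pairwise within the connection distance $r$ of each other. Put $\theta=(r/a)^d$, which depends on $n$, and assume $\theta\le(1/2)^d$. $K$ is the integer such that the largest simplices of the complex are $K$-simplices (so $K+1$ is the clique number of the underlying graph). For non-negative functions, $f(n)\sim g(n)$ means $f(n)=O(g(n))$ and $g(n)=O(f(n))$ as $n\to\infty$. A property holds asymptotically almost surely if its probability tends to $1$ as $n\to\infty$. *)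

theory Defs
  imports "HOL-Probability.Probability" "HOL-Library.Landau_Symbols"
begin

text \<open>The torus of side \<open>a\<close> is represented by the fundamental domain \<open>[0, a)\<close> to the power \<open>d\<close> of
  the quotient of \<open>d\<close>-space by the lattice of integer vectors scaled by \<open>a\<close>.\<close>

definition torus :: "real \<Rightarrow> (real ^ 'd) set" where
  "torus a = {x. \<forall>i. 0 \<le> x $ i \<and> x $ i < a}"

text \<open>The quotient distance: the least uniform-norm distance between lattice translates.\<close>

definition torus_dist :: "real \<Rightarrow> real ^ 'd \<Rightarrow> real ^ 'd \<Rightarrow> real" where
  "torus_dist a x y = (INF k :: int ^ 'd. infnorm (x - y + a *\<^sub>R (\<chi> i. of_int (k $ i))))"

text \<open>The random points are \<open>X 0, \<dots>, X (n - 1)\<close>.\<close>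

definition binomial_points :: "'w measure \<Rightarrow> nat \<Rightarrow> real \<Rightarrow> (nat \<Rightarrow> 'w \<Rightarrow> real ^ 'd) \<Rightarrow> bool" where
  "binomial_points M n a X \<longleftrightarrow>
     prob_space M \<and>
     prob_space.indep_vars M (\<lambda>_. borel) X {..<n} \<and>
     (\<forall>i<n. distr M borel (X i) = uniform_measure lborel (torus a))"

definition vietoris_rips :: "real \<Rightarrow> real \<Rightarrow> (real ^ 'd) set \<Rightarrow> (real ^ 'd) set set" where
  "vietoris_rips a r V =
     {\<sigma>. \<sigma> \<subseteq> V \<and> \<sigma> \<noteq> {} \<and> finite \<sigma> \<and> (\<forall>x\<in>\<sigma>. \<forall>y\<in>\<sigma>. torus_dist a x y \<le> r)}"

text \<open>Only meaningful for a complex that is finite and has at least one simplex.\<close>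

definition complex_dim :: "'v set set \<Rightarrow> nat" where
  "complex_dim C = Max {k. \<exists>\<sigma>\<in>C. card \<sigma> = k + 1}"

end

theory Submission
  imports Defs "HOL-Real_Asymp.Real_Asymp"
begin

text \<open>Both bounds compare the torus with a grid of \<open>N = m ^ d\<close> congruent cells, where \<open>N\<close> is of order
  \<open>n\<close>. If the cell side exceeds \<open>r\<close>, every clique lies in one of \<open>N\<close> blocks of \<open>3 ^ d\<close> cells, so by
  the union bound a clique of \<open>j\<close> points has probability at most
  \<open>N * (n choose j) * (3 ^ d / N) ^ j\<close>, which is \<open>O(n * C ^ j / fact j)\<close> and tends to \<open>0\<close> for
  \<open>j \<ge> ln n\<close>. If the cell side is at most \<open>r\<close>, any \<open>j\<close> points in one cell form a clique. The second
  moment method, applied to the number of pairs of a cell and a \<open>j\<close>-subset of the points contained in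
  it, shows that with probability tending to \<open>1\<close> there is such a pair whenever
  \<open>j * ln j = o(ln n)\<close>, in particular for \<open>j\<close> of order \<open>(ln n) powr (1 - \<eta>)\<close>.\<close>

section \<open>Grids of half-open cubes and the tiling of the torus\<close>

text \<open>Half-open cubes partition space without overlap. Indexing them by functions makes
  \<open>cells m\<close> a \<open>PiE\<close> set, whose cardinality is immediate.\<close>

definition cube :: "real \<Rightarrow> ('d \<Rightarrow> int) \<Rightarrow> (real ^ 'd) set" where
  "cube s c = {x. \<forall>i. \<lfloor>x $ i / s\<rfloor> = c i}"

definition cells :: "nat \<Rightarrow> ('d::finite \<Rightarrow> int) set" where
  "cells m = (\<Pi>\<^sub>E i\<in>UNIV. {0..<int m})"

lemma finite_cells: "finite (cells m)"
  by (simp add: cells_def finite_PiE)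

lemma card_cells: "card (cells m :: ('d::finite \<Rightarrow> int) set) = m ^ CARD('d)"
  by (simp add: cells_def card_PiE)

lemma in_cells_iff: "c \<in> cells m \<longleftrightarrow> (\<forall>i. 0 \<le> c i \<and> c i < int m)"
  by (auto simp: cells_def PiE_iff)

lemma cube_disjoint: "c \<noteq> c' \<Longrightarrow> cube s c \<inter> cube s c' = {}"
  by (auto simp: cube_def fun_eq_iff)

lemma mem_cube_iff:
  assumes "s > 0"
  shows "x \<in> cube s c \<longleftrightarrow> (\<forall>i. of_int (c i) * s \<le> x $ i \<and> x $ i < (of_int (c i) + 1) * s)"
  using assms by (simp add: cube_def floor_eq_iff field_simps)

lemma cube_borel [measurable]: "cube s c \<in> sets borel"
  unfolding cube_def by measurable

lemma torus_borel [measurable]: "torus a \<in> sets borel"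
  unfolding torus_def by measurable

text \<open>Squeezed between an open and a closed box of equal volume.\<close>

lemma emeasure_cube:
  assumes "s > 0"
  shows "emeasure lborel (cube s c :: (real ^ 'd) set) = ennreal (s ^ CARD('d))"
proof -
  define l :: "real ^ 'd" where "l = (\<chi> i. of_int (c i) * s)"
  define u :: "real ^ 'd" where "u = (\<chi> i. (of_int (c i) + 1) * s)"
  have "box l u \<subseteq> cube s c"
    by (auto simp: mem_cube_iff[OF assms] l_def u_def mem_box_cart less_le)
  moreover have "cube s c \<subseteq> cbox l u"
    by (auto simp: mem_cube_iff[OF assms] l_def u_def mem_box_cart less_le)
  ultimately have "emeasure lborel (box l u) \<le> emeasure lborel (cube s c)"
    "emeasure lborel (cube s c) \<le> emeasure lborel (cbox l u)"
    by (auto intro!: emeasure_mono)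
  moreover have "emeasure lborel (box l u) = emeasure lborel (cbox l u)"
    by (simp add: emeasure_lborel_box_eq emeasure_lborel_cbox_eq)
  moreover have "emeasure lborel (cbox l u) = ennreal (s ^ CARD('d))"
  proof -
    have "l \<in> cbox l u" using assms by (auto simp: mem_box_cart l_def u_def algebra_simps)
    hence "measure lborel (cbox l u) = s ^ CARD('d)"
      by (subst content_cbox_cart) (auto simp: l_def u_def algebra_simps)
    thus ?thesis
      by (metis emeasure_eq_ennreal_measure emeasure_lborel_cbox_finite less_irrefl infinity_ennreal_def)
  qed
  ultimately show ?thesis by (metis antisym)
qed

text \<open>Makes the volume of the torus an instance of \<open>emeasure_cube\<close>.\<close>

lemma torus_eq_cube: "a > 0 \<Longrightarrow> torus a = cube a (\<lambda>_. 0)"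
  by (auto simp: torus_def mem_cube_iff)

lemma cube_subset_torus:
  assumes "a > 0" "m \<ge> 1" "c \<in> cells m"
  shows "cube (a / real m) c \<subseteq> torus a"
proof
  fix x :: "real ^ 'a" assume x: "x \<in> cube (a / real m) c"
  have "0 \<le> x $ i \<and> x $ i < a" for i
  proof -
    have c: "0 \<le> c i" "c i + 1 \<le> int m" using assms(3) by (auto simp: in_cells_iff zless_imp_add1_zle)
    have *: "of_int (c i) * (a / real m) \<le> x $ i" "x $ i < (of_int (c i) + 1) * (a / real m)"
      using x assms by (auto simp: mem_cube_iff)
    have "0 \<le> of_int (c i) * (a / real m)" using c assms by simp
    moreover have "(of_int (c i) + 1 :: real) \<le> real m" using c(2)
      by (metis of_int_1 of_int_add of_int_le_iff of_int_of_nat_eq)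
    hence "(of_int (c i) + 1) * (a / real m) \<le> real m * (a / real m)"
      using assms by (intro mult_right_mono) auto
    ultimately show ?thesis using * assms by auto
  qed
  thus "x \<in> torus a" by (simp add: torus_def)
qed

text \<open>Together with \<open>cube_subset_torus\<close>, this shows that the cells indexed by
  \<open>cells m\<close> tile the torus exactly.\<close>

lemma torus_mem_cells:
  assumes "a > 0" "m \<ge> 1" "x \<in> torus a"
  shows "(\<lambda>i. \<lfloor>x $ i / (a / real m)\<rfloor>) \<in> cells m"
  using assms by (auto simp: in_cells_iff torus_def floor_less_iff field_simps)

section \<open>The quotient distance\<close>

lemma bdd_below_torus_dist:
  "bdd_below (range (\<lambda>k :: int ^ 'd. infnorm (x - y + a *\<^sub>R (\<chi> i. of_int (k $ i)))))"
  by (rule bdd_belowI[of _ 0]) (auto simp: infnorm_pos_le)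

lemma torus_dist_le_infnorm: "torus_dist a x y \<le> infnorm (x - y)"
proof -
  have "torus_dist a x y \<le> infnorm (x - y + a *\<^sub>R (\<chi> i. of_int ((0 :: int ^ 'a) $ i)))"
    unfolding torus_dist_def by (rule cINF_lower[OF bdd_below_torus_dist]) simp
  also have "(\<chi> i. of_int ((0 :: int ^ 'a) $ i)) = (0 :: real ^ 'a)" by (simp add: vec_eq_iff)
  finally show ?thesis by simp
qed

text \<open>The strict bound on the infimum yields an explicit translate without an argument that
  the infimum is attained. The strict inequality in \<open>mem_block\<close> has its origin
  here.\<close>

lemma torus_dist_less_obtain:
  assumes "torus_dist a x y < t"
  obtains k :: "'d::finite \<Rightarrow> int" where "\<And>i. \<bar>x $ i - y $ i + a * of_int (k i)\<bar> < t"
proof -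
  obtain k :: "int ^ 'd" where k: "infnorm (x - y + a *\<^sub>R (\<chi> i. of_int (k $ i))) < t"
    using assms unfolding torus_dist_def by (subst (asm) cINF_less_iff[OF _ bdd_below_torus_dist]) auto
  have "\<bar>x $ i - y $ i + a * of_int (k $ i)\<bar> < t" for i
    using component_le_infnorm_cart[of "x - y + a *\<^sub>R (\<chi> i. of_int (k $ i))" i] k by simp
  thus thesis by (rule that)
qed

text \<open>The infimum runs over countably many lattice vectors, so it preserves
  measurability.\<close>

lemma borel_measurable_torus_dist [measurable]:
  assumes [measurable]: "f \<in> borel_measurable M" "g \<in> borel_measurable M"
  shows "(\<lambda>\<omega>. torus_dist a (f \<omega>) (g \<omega>)) \<in> borel_measurable M"
proof -
  have [measurable]: "(infnorm :: real ^ 'd \<Rightarrow> real) \<in> borel_measurable borel"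
    by (intro borel_measurable_continuous_onI continuous_at_imp_continuous_on ballI)
       (simp add: continuous_at tendsto_infnorm)
  show ?thesis unfolding torus_dist_def
    by (intro borel_measurable_cINF bdd_below_torus_dist) auto
qed

lemma torus_dist_same_cube:
  assumes "s > 0" "x \<in> cube s c" "y \<in> cube s c"
  shows "torus_dist a x y \<le> s"
proof -
  have "\<bar>x $ i - y $ i\<bar> \<le> s" for i
    using assms by (auto simp: mem_cube_iff abs_le_iff algebra_simps) (smt (verit, best))+
  hence "infnorm (x - y) \<le> s" by (auto simp: infnorm_cart intro!: cSup_least)
  thus ?thesis using torus_dist_le_infnorm[of a x y] by simp
qed

section \<open>Cliques and the dimension of the complex\<close>

text \<open>Cliques are index sets rather than point sets, so that union bounds range over
  deterministic objects. Injectivity makes the size of the index set the number of vertices.\<close>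

definition clique :: "real \<Rightarrow> real \<Rightarrow> (nat \<Rightarrow> real ^ 'd) \<Rightarrow> nat set \<Rightarrow> bool" where
  "clique a r x S \<longleftrightarrow> inj_on x S \<and> (\<forall>i\<in>S. \<forall>j\<in>S. torus_dist a (x i) (x j) \<le> r)"

lemma clique_subset: "clique a r x S \<Longrightarrow> T \<subseteq> S \<Longrightarrow> clique a r x T"
  by (auto simp: clique_def intro: inj_on_subset)

text \<open>Subsets of cliques are cliques, so the dimensions that occur form a finite initial
  segment, and lying below its maximum is the same as occurring. This turns bounds on
  \<open>K\<close> into clique events.\<close>

lemma le_complex_dim_iff:
  assumes n: "n \<ge> 1" and r: "r \<ge> 0"
  shows "k \<le> complex_dim (vietoris_rips a r (x ` {..<n})) \<longleftrightarrow>
    (\<exists>S\<subseteq>{..<n}. card S = k + 1 \<and> clique a r x S)"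
proof -
  define D where "D = {k. \<exists>\<sigma>\<in>vietoris_rips a r (x ` {..<n}). card \<sigma> = k + 1}"
  have D: "k \<in> D \<longleftrightarrow> (\<exists>S\<subseteq>{..<n}. card S = k + 1 \<and> clique a r x S)" for k
  proof
    assume "k \<in> D"
    then obtain \<sigma> where \<sigma>: "\<sigma> \<subseteq> x ` {..<n}" "\<forall>u\<in>\<sigma>. \<forall>v\<in>\<sigma>. torus_dist a u v \<le> r" "card \<sigma> = k + 1"
      by (auto simp: D_def vietoris_rips_def)
    \<comment> \<open>One index is chosen per vertex, since several indices may carry the same
      point.\<close>
    then obtain S where "S \<subseteq> {..<n}" "inj_on x S" "\<sigma> = x ` S"
      by (meson subset_image_inj)
    with \<sigma> show "\<exists>S\<subseteq>{..<n}. card S = k + 1 \<and> clique a r x S"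
      by (intro exI[of _ S]) (auto simp: clique_def card_image)
  next
    assume "\<exists>S\<subseteq>{..<n}. card S = k + 1 \<and> clique a r x S"
    then obtain S where S: "S \<subseteq> {..<n}" "card S = k + 1" "clique a r x S" by blast
    moreover have "finite S" "S \<noteq> {}" using S(2) by (auto intro: card_ge_0_finite)
    ultimately have "x ` S \<in> vietoris_rips a r (x ` {..<n})" "card (x ` S) = k + 1"
      by (auto simp: vietoris_rips_def clique_def card_image)
    thus "k \<in> D" by (auto simp: D_def)
  qed
  have "k < n" if "k \<in> D" for k
    using that card_mono[of "{..<n}"] unfolding D by (metis card_lessThan finite_lessThan
      less_eq_Suc_le Suc_eq_plus1)
  hence fin: "finite D" by (meson finite_nat_iff_bounded lessThan_iff subsetI)
  \<comment> \<open>\<open>n \<ge> 1\<close> and \<open>r \<ge> 0\<close> make a single point a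
    simplex, so \<open>Max\<close> is taken over a nonempty set.\<close>
  have "torus_dist a (x 0) (x 0) \<le> r"
    using torus_dist_le_infnorm[of a "x 0" "x 0"] r by (simp add: infnorm_0)
  hence "0 \<in> D" unfolding D using n by (intro exI[of _ "{0}"]) (auto simp: clique_def)
  hence "Max D \<in> D" using fin by (intro Max_in) auto
  have "k \<in> D" if "k \<le> Max D"
  proof -
    obtain S where S: "S \<subseteq> {..<n}" "card S = Max D + 1" "clique a r x S"
      using \<open>Max D \<in> D\<close> unfolding D by blast
    obtain T where "T \<subseteq> S" "card T = k + 1"
      using S(2) \<open>k \<le> Max D\<close> by (metis add_le_mono1 obtain_subset_with_card_n)
    thus ?thesis unfolding D using S clique_subset by (intro exI[of _ T]) blast
  qed
  moreover have "complex_dim (vietoris_rips a r (x ` {..<n})) = Max D"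
    by (simp add: complex_dim_def D_def)
  ultimately show ?thesis using fin D Max_ge by metis
qed

section \<open>The law of the random points\<close>

text \<open>The process for one fixed \<open>n\<close>. The theorem interprets it for each large
  \<open>n\<close>, as the probability space may vary with \<open>n\<close>.\<close>

locale torus_process = prob_space M for M :: "'w measure" +
  fixes n :: nat and a :: real and X :: "nat \<Rightarrow> 'w \<Rightarrow> real ^ 'd"
  assumes a_pos: "a > 0"
    and indep: "indep_vars (\<lambda>_. borel) X {..<n}"
    and distr_X: "i < n \<Longrightarrow> distr M borel (X i) = uniform_measure lborel (torus a)"
begin

lemma X_measurable [measurable]: "i < n \<Longrightarrow> X i \<in> borel_measurable M"
  using indep unfolding indep_vars_def by auto

lemma prob_X:
  assumes "i < n" "B \<in> sets borel"
  shows "prob {\<omega> \<in> space M. X i \<omega> \<in> B} = measure lborel (torus a \<inter> B) / a ^ CARD('d)"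
proof -
  have em: "emeasure lborel (torus a :: (real ^ 'd) set) = ennreal (a ^ CARD('d))"
    using a_pos emeasure_cube torus_eq_cube by metis
  have "prob {\<omega> \<in> space M. X i \<omega> \<in> B} = measure (distr M borel (X i)) B"
    using assms by (subst measure_distr) (auto intro!: arg_cong[where f = prob])
  also have "\<dots> = measure lborel (torus a \<inter> B) / measure lborel (torus a :: (real ^ 'd) set)"
    unfolding distr_X[OF assms(1)] using assms em a_pos
    by (subst measure_uniform_measure) auto
  also have "measure lborel (torus a :: (real ^ 'd) set) = a ^ CARD('d)"
    using em a_pos by (simp add: measure_def)
  finally show ?thesis .
qed

lemma prob_cube:
  assumes "i < n" "m \<ge> 1" "c \<in> cells m"
  shows "prob {\<omega> \<in> space M. X i \<omega> \<in> cube (a / real m) c} = 1 / real m ^ CARD('d)"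
proof -
  have "torus a \<inter> cube (a / real m) c = cube (a / real m) c"
    using cube_subset_torus[OF a_pos assms(2,3)] by auto
  moreover have "measure lborel (cube (a / real m) c) = (a / real m) ^ CARD('d)"
    using assms a_pos emeasure_cube[of "a / real m" c] by (simp add: measure_def)
  ultimately show ?thesis using assms a_pos by (simp add: prob_X power_divide)
qed

text \<open>The uniform law gives the torus full mass. Points may still leave it on a null set, so
  later inclusions of events are stated almost everywhere.\<close>

lemma AE_torus: "AE \<omega> in M. \<forall>i<n. X i \<omega> \<in> torus a"
proof -
  have "AE \<omega> in M. X i \<omega> \<in> torus a" if "i < n" for i
  proof -
    have "measure lborel (torus a :: (real ^ 'd) set) = a ^ CARD('d)"
      using emeasure_cube[OF a_pos, of "\<lambda>_::'d. 0"] a_pos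
      by (simp add: measure_def torus_eq_cube)
    hence "prob {\<omega> \<in> space M. X i \<omega> \<in> torus a} = 1"
      using a_pos that by (subst prob_X) auto
    thus ?thesis using that by (subst (asm) prob_Collect_eq_1) auto
  qed
  thus ?thesis by (simp add: AE_all_countable)
qed

lemma prob_all:
  assumes "S \<subseteq> {..<n}" "\<And>i. i \<in> S \<Longrightarrow> B i \<in> sets borel"
  shows "prob {\<omega> \<in> space M. \<forall>i\<in>S. X i \<omega> \<in> B i} = (\<Prod>i\<in>S. prob {\<omega> \<in> space M. X i \<omega> \<in> B i})"
\<comment> \<open>\<open>indep_varsD\<close> asks for a nonempty index set.\<close>
proof (cases "S = {}")
  case True thus ?thesis by (simp add: prob_space)
next
  case False
  have fin: "finite S" using assms finite_subset by blast
  have "prob (\<Inter>i\<in>S. X i -` B i \<inter> space M) = (\<Prod>i\<in>S. prob (X i -` B i \<inter> space M))"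
    using indep False fin assms by (intro indep_varsD) auto
  moreover have "(\<Inter>i\<in>S. X i -` B i \<inter> space M) = {\<omega> \<in> space M. \<forall>i\<in>S. X i \<omega> \<in> B i}"
    using False by auto
  moreover have "X i -` B i \<inter> space M = {\<omega> \<in> space M. X i \<omega> \<in> B i}" for i by auto
  ultimately show ?thesis by simp
qed

end

section \<open>Elementary estimates and the second moment method\<close>

text \<open>The source of the \<open>3\<close> in \<open>3 ^ d\<close>: points closer than one cell
  side have cell indices differing by at most one per coordinate.\<close>

lemma floor_diff_bounds:
  fixes u v :: real
  assumes "\<bar>u - v\<bar> < 1"
  shows "\<lfloor>u\<rfloor> - \<lfloor>v\<rfloor> \<in> {-1..1}"
proof -
  have "\<lfloor>u\<rfloor> < \<lfloor>v\<rfloor> + 2" "\<lfloor>v\<rfloor> < \<lfloor>u\<rfloor> + 2" using assms by linarith+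
  thus ?thesis by simp
qed

text \<open>Enlarge the family to all subsets of \<open>A\<close> and split \<open>T\<close> into
  \<open>T \<inter> S\<close>, with \<open>2 ^ card S\<close> choices, and \<open>T - S\<close>,
  whose weights sum to a binomial expansion. This controls overlapping subsets of points in one
  cell.\<close>

lemma sum_power_card_Diff_le:
  fixes p :: real
  assumes "finite A" "S \<subseteq> A" "p \<ge> 0" "\<S> \<subseteq> Pow A"
  shows "(\<Sum>T\<in>\<S>. p ^ card (T - S)) \<le> 2 ^ card S * (1 + p) ^ card A"
proof -
  have fin: "finite S" "finite (A - S)" using assms finite_subset by auto
  have "(\<Sum>T\<in>\<S>. p ^ card (T - S)) \<le> (\<Sum>T\<in>Pow A. p ^ card (T - S))"
    using assms by (intro sum_mono2) auto
  also have "\<dots> = (\<Sum>(U, V)\<in>Pow S \<times> Pow (A - S). p ^ card V)"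
    using assms(2)
    by (intro sum.reindex_bij_witness[where j = "\<lambda>T. (T \<inter> S, T - S)" and i = "\<lambda>(U, V). U \<union> V"]) auto
  also have "\<dots> = 2 ^ card S * (\<Sum>V\<in>Pow (A - S). p ^ card V)"
    using fin by (simp add: sum.cartesian_product[symmetric] card_Pow)
  also have "(\<Sum>V\<in>Pow (A - S). p ^ card V) = (1 + p) ^ card (A - S)"
    using prod_add[OF fin(2), of "\<lambda>_. p" "\<lambda>_. 1"] by (simp add: add.commute)
  also have "\<dots> \<le> (1 + p) ^ card A"
    using assms by (intro power_increasing card_mono) auto
  finally show ?thesis by simp
qed

text \<open>Chebyshev for the number \<open>U\<close> of events that occur: if none occurs,
  \<open>U\<close> is at distance \<open>\<mu>\<close> from its mean, and \<open>D\<close> bounds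
  the variance because the double sum is the second moment of \<open>U\<close>.\<close>

lemma (in prob_space) prob_none_le:
  assumes fin: "finite T" and A: "\<And>t. t \<in> T \<Longrightarrow> A t \<in> events"
    and \<mu>: "\<mu> = (\<Sum>t\<in>T. prob (A t))" "\<mu> > 0"
    and D: "(\<Sum>t\<in>T. \<Sum>t'\<in>T. prob (A t \<inter> A t')) \<le> \<mu>\<^sup>2 + D"
  shows "prob {\<omega> \<in> space M. \<forall>t\<in>T. \<omega> \<notin> A t} \<le> D / \<mu>\<^sup>2"
proof -
  define U :: "'a \<Rightarrow> real" where "U \<omega> = (\<Sum>t\<in>T. indicator (A t) \<omega>)" for \<omega>
  have [measurable]: "t \<in> T \<Longrightarrow> A t \<in> events" for t by (rule A)
  have U2: "(U \<omega>)\<^sup>2 = (\<Sum>t\<in>T. \<Sum>t'\<in>T. indicator (A t \<inter> A t') \<omega>)" for \<omega>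
    by (simp add: U_def power2_eq_square sum_product indicator_inter_arith)
  have ind: "integrable M (indicator B :: 'a \<Rightarrow> real)" if "B \<in> events" for B
    using that by (intro integrable_real_indicator) (auto simp: less_top[symmetric])
  have int: "integrable M U" unfolding U_def by (intro Bochner_Integration.integrable_sum ind) auto
  have int2: "integrable M (\<lambda>\<omega>. (U \<omega>)\<^sup>2)"
    unfolding U2 by (intro Bochner_Integration.integrable_sum ind) auto
  have EU: "expectation U = \<mu>"
    unfolding U_def \<mu> by (subst Bochner_Integration.integral_sum) (auto simp: A ind)
  have EU2: "expectation (\<lambda>\<omega>. (U \<omega>)\<^sup>2) = (\<Sum>t\<in>T. \<Sum>t'\<in>T. prob (A t \<inter> A t'))"
    unfolding U2 by (subst Bochner_Integration.integral_sum)
      (auto simp: A ind Bochner_Integration.integral_sum intro!: Bochner_Integration.integrable_sum sum.cong)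
  have [measurable]: "U \<in> borel_measurable M" using int by auto
  have "{\<omega> \<in> space M. \<forall>t\<in>T. \<omega> \<notin> A t} \<subseteq> {\<omega> \<in> space M. \<mu> \<le> \<bar>U \<omega> - expectation U\<bar>}"
    by (auto simp: EU) (simp add: U_def)
  hence "prob {\<omega> \<in> space M. \<forall>t\<in>T. \<omega> \<notin> A t} \<le> prob {\<omega> \<in> space M. \<mu> \<le> \<bar>U \<omega> - expectation U\<bar>}"
    by (intro finite_measure_mono) auto
  also have "\<dots> \<le> variance U / \<mu>\<^sup>2"
    using int2 \<mu>(2) by (intro Chebyshev_inequality) auto
  also have "variance U \<le> D"
    using D variance_eq[OF int int2] unfolding EU EU2 by simp
  finally show ?thesis using \<mu>(2) by (simp add: divide_right_mono)
qed

section \<open>Cell probabilities and distinctness of the points\<close>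

context torus_process
begin

lemma prob_all_cube:
  assumes "S \<subseteq> {..<n}" "m \<ge> 1" "c \<in> cells m"
  shows "prob {\<omega> \<in> space M. \<forall>i\<in>S. X i \<omega> \<in> cube (a / real m) c} = (1 / real (m ^ CARD('d))) ^ card S"
  using assms prob_cube by (subst prob_all) (auto simp: subset_eq cube_borel)

text \<open>Coinciding points share a cell, and each of the \<open>?N\<close> cells holds both
  points with probability \<open>(1 / ?N)\<^sup>2\<close>.\<close>

lemma prob_eq_le:
  assumes ij: "i < n" "j < n" "i \<noteq> j" and m: "m \<ge> 1"
  shows "prob {\<omega> \<in> space M. X i \<omega> = X j \<omega>} \<le> 1 / real (m ^ CARD('d))"
proof -
  let ?N = "m ^ CARD('d)"
  let ?F = "\<lambda>c. {\<omega> \<in> space M. \<forall>l\<in>{i,j}. X l \<omega> \<in> cube (a / real m) c}"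
  have [measurable]: "l \<in> {i, j} \<Longrightarrow> X l \<in> borel_measurable M" for l using ij by auto
  have F: "?F c \<in> events" for c by measurable
  have "AE \<omega> in M. \<omega> \<in> {\<omega> \<in> space M. X i \<omega> = X j \<omega>} \<longrightarrow> \<omega> \<in> (\<Union>c\<in>cells m. ?F c)"
    using AE_torus
  proof eventually_elim
    case (elim \<omega>)
    thus ?case using torus_mem_cells[OF a_pos m, of "X i \<omega>"] ij
      by (auto simp: cube_def intro!: bexI[of _ "\<lambda>k. \<lfloor>X i \<omega> $ k / (a / real m)\<rfloor>"])
  qed
  hence "prob {\<omega> \<in> space M. X i \<omega> = X j \<omega>} \<le> prob (\<Union>c\<in>cells m. ?F c)"
    using F finite_cells by (intro finite_measure_mono_AE) auto
  also have "\<dots> \<le> (\<Sum>c\<in>cells m. prob (?F c))"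
    using F finite_cells by (intro finite_measure_subadditive_finite) auto
  also have "\<dots> = (\<Sum>c\<in>(cells m :: ('d \<Rightarrow> int) set). (1 / real ?N)\<^sup>2)"
    using ij m by (intro sum.cong refl) (subst prob_all_cube, auto simp: power2_eq_square)
  also have "\<dots> = 1 / real ?N" by (simp add: card_cells power2_eq_square)
  finally show ?thesis .
qed

text \<open>\<open>prob_eq_le\<close> holds for every grid, so refining the grid forces the
  probability of a coincidence to be \<open>0\<close>.\<close>

lemma AE_inj: "AE \<omega> in M. inj_on (\<lambda>i. X i \<omega>) {..<n}"
proof -
  have ne: "AE \<omega> in M. X i \<omega> \<noteq> X j \<omega>" if ij: "i < n" "j < n" "i \<noteq> j" for i j
  proof -
    have le: "prob {\<omega> \<in> space M. X i \<omega> = X j \<omega>} \<le> inverse (real (Suc m))" for m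
    proof -
      \<comment> \<open>The dimension is at least one, so there are at least \<open>Suc m\<close>
        cells.\<close>
      have "real (Suc m) ^ 1 \<le> real (Suc m) ^ CARD('d)"
        by (rule power_increasing) (auto simp: Suc_leI)
      hence "1 / real (Suc m ^ CARD('d)) \<le> inverse (real (Suc m))"
        by (simp add: field_simps del: of_nat_Suc)
      thus ?thesis using prob_eq_le[OF ij, of "Suc m"] by linarith
    qed
    have "prob {\<omega> \<in> space M. X i \<omega> = X j \<omega>} = 0"
    proof (rule ccontr)
      assume "prob {\<omega> \<in> space M. X i \<omega> = X j \<omega>} \<noteq> 0"
      hence "prob {\<omega> \<in> space M. X i \<omega> = X j \<omega>} > 0" by (simp add: zero_less_measure_iff)
      from reals_Archimedean[OF this] le show False by (meson not_less)
    qed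
    thus ?thesis using ij by (subst (asm) prob_Collect_eq_0) auto
  qed
  have "AE \<omega> in M. \<forall>i\<in>{..<n}. \<forall>j\<in>{..<n}. i \<noteq> j \<longrightarrow> X i \<omega> \<noteq> X j \<omega>"
    using ne by (intro AE_finite_allI) auto
  thus ?thesis by eventually_elim (auto simp: inj_on_def)
qed

section \<open>Clique events and the union bound over blocks of cells\<close>

lemma clique_event: "{\<omega> \<in> space M. \<exists>S\<subseteq>{..<n}. card S = k \<and> clique a r (\<lambda>i. X i \<omega>) S} \<in> events"
proof -
  have "{\<omega> \<in> space M. clique a r (\<lambda>i. X i \<omega>) S} \<in> events" if "S \<subseteq> {..<n}" for S
  proof -
    have [measurable]: "finite S" "\<And>i. i \<in> S \<Longrightarrow> X i \<in> borel_measurable M"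
      using that finite_subset by auto
    show ?thesis unfolding clique_def inj_on_def by measurable
  qed
  hence "(\<Union>S\<in>{S. S \<subseteq> {..<n} \<and> card S = k}. {\<omega> \<in> space M. clique a r (\<lambda>i. X i \<omega>) S}) \<in> events"
    by (intro sets.finite_UN) auto
  also have "(\<Union>S\<in>{S. S \<subseteq> {..<n} \<and> card S = k}. {\<omega> \<in> space M. clique a r (\<lambda>i. X i \<omega>) S}) =
    {\<omega> \<in> space M. \<exists>S\<subseteq>{..<n}. card S = k \<and> clique a r (\<lambda>i. X i \<omega>) S}" by auto
  finally show ?thesis .
qed

text \<open>A clique of radius less than the cell size lies in the block of \<open>3 ^ d\<close> cells around the cell
  of any of its points.\<close>

definition block :: "nat \<Rightarrow> ('d \<Rightarrow> int) \<Rightarrow> (real ^ 'd) set" where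
  "block m c = (\<Union>e\<in>(\<Pi>\<^sub>E i\<in>UNIV. {-1..1}). cube (a / real m) (\<lambda>i. (c i + e i) mod int m))"

lemma block_borel [measurable]: "block m c \<in> sets borel"
  unfolding block_def by (intro sets.finite_UN finite_PiE) (auto simp: cube_borel)

text \<open>Reduction modulo \<open>m\<close> brings shifted indices back into
  \<open>cells m\<close>. For \<open>m < 3\<close> some of the \<open>3 ^ d\<close> cells coincide,
  so subadditivity is used rather than disjointness.\<close>

lemma prob_block_le:
  assumes "i < n" "m \<ge> 1"
  shows "prob {\<omega> \<in> space M. X i \<omega> \<in> block m c} \<le> 3 ^ CARD('d) / real (m ^ CARD('d))"
proof -
  let ?E = "\<Pi>\<^sub>E i\<in>(UNIV :: 'd set). {-1..1::int}"
  let ?F = "\<lambda>e. {\<omega> \<in> space M. X i \<omega> \<in> cube (a / real m) (\<lambda>i. (c i + e i) mod int m)}"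
  have fin: "finite ?E" by (simp add: finite_PiE)
  have "prob {\<omega> \<in> space M. X i \<omega> \<in> block m c} = prob (\<Union>e\<in>?E. ?F e)"
    by (intro arg_cong[where f = prob]) (auto simp: block_def)
  also have "\<dots> \<le> (\<Sum>e\<in>?E. prob (?F e))"
  proof (intro finite_measure_subadditive_finite fin)
    have "?F e \<in> events" for e using assms by measurable
    thus "?F ` ?E \<subseteq> events" by blast
  qed
  also have "\<dots> = (\<Sum>e\<in>?E. 1 / real m ^ CARD('d))"
    using assms by (intro sum.cong refl prob_cube) (auto simp: in_cells_iff)
  also have "\<dots> = 3 ^ CARD('d) / real (m ^ CARD('d))"
    by (simp add: card_PiE)
  finally show ?thesis .
qed

lemma mem_block:
  assumes m: "m \<ge> 1" and x: "x \<in> torus a" and dist: "torus_dist a x y < a / real m"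
  shows "x \<in> block m (\<lambda>i. \<lfloor>y $ i / (a / real m)\<rfloor>)"
proof -
  define s where "s = a / real m"
  have s: "s > 0" "a = real m * s" using a_pos m by (auto simp: s_def)
  obtain k where k: "\<And>i. \<bar>x $ i - y $ i + a * of_int (k i)\<bar> < s"
    using torus_dist_less_obtain[OF dist] unfolding s_def by blast
  \<comment> \<open>Translation by \<open>a * k i\<close> shifts the cell index by
    \<open>m * k i\<close>, so \<open>e i\<close> is the offset of the translated \<open>x\<close>
    from the cell of \<open>y\<close>.\<close>
  define e where "e i = \<lfloor>x $ i / s\<rfloor> + int m * k i - \<lfloor>y $ i / s\<rfloor>" for i
  have e: "e i \<in> {-1..1}" for i
  proof -
    have "\<bar>(x $ i - y $ i + a * of_int (k i)) / s\<bar> < 1"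
      using k[of i] s(1) by (simp add: abs_divide)
    also have "(x $ i - y $ i + a * of_int (k i)) / s = x $ i / s + of_int (int m * k i) - y $ i / s"
      using s(1) by (simp add: s(2) field_simps)
    finally have "\<bar>x $ i / s + of_int (int m * k i) - y $ i / s\<bar> < 1" .
    moreover have "e i = \<lfloor>x $ i / s + of_int (int m * k i)\<rfloor> - \<lfloor>y $ i / s\<rfloor>"
      unfolding e_def by (subst floor_add_int) auto
    ultimately show ?thesis using floor_diff_bounds by metis
  qed
  \<comment> \<open>The term \<open>m * k i\<close> vanishes modulo \<open>m\<close>, and the index
    of \<open>x\<close> is already reduced since \<open>x\<close> lies in the fundamental
    domain.\<close>
  have "\<lfloor>x $ i / s\<rfloor> = (\<lfloor>y $ i / s\<rfloor> + e i) mod int m" for i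
  proof -
    have "\<lfloor>x $ i / s\<rfloor> = \<lfloor>x $ i / s\<rfloor> mod int m"
      using torus_mem_cells[OF a_pos m x] by (simp add: in_cells_iff s_def)
    thus ?thesis by (simp add: e_def)
  qed
  thus ?thesis using e unfolding block_def cube_def s_def[symmetric]
    by (auto intro!: bexI[of _ e])
qed

text \<open>The clique event is covered by pairs of a cell \<open>c\<close> and an index set
  \<open>S\<close> with all its points in \<open>block m c\<close>. As \<open>c\<close> is fixed and
  not read off a random point, independence gives a product for each pair.\<close>

lemma prob_clique_le:
  assumes m: "m \<ge> 1" and r: "r < a / real m" and j: "j \<ge> 1"
  shows "prob {\<omega> \<in> space M. \<exists>S\<subseteq>{..<n}. card S = j \<and> clique a r (\<lambda>i. X i \<omega>) S}
    \<le> real (m ^ CARD('d)) * real (n choose j) * (3 ^ CARD('d) / real (m ^ CARD('d))) ^ j"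
proof -
  let ?q = "3 ^ CARD('d) / real (m ^ CARD('d))"
  let ?T = "(cells m :: ('d \<Rightarrow> int) set) \<times> {S. S \<subseteq> {..<n} \<and> card S = j}"
  let ?F = "\<lambda>(c, S). {\<omega> \<in> space M. \<forall>i\<in>S. X i \<omega> \<in> block m c}"
  have fin: "finite ?T" by (intro finite_cartesian_product finite_cells) simp
  have F: "?F t \<in> events" if "t \<in> ?T" for t
  proof -
    obtain c S where t: "t = (c, S)" "S \<subseteq> {..<n}" using \<open>t \<in> ?T\<close> by auto
    have [measurable]: "finite S" "\<And>i. i \<in> S \<Longrightarrow> X i \<in> borel_measurable M"
      using t(2) finite_subset by auto
    show ?thesis unfolding t by simp measurable
  qed
  have "AE \<omega> in M. \<omega> \<in> {\<omega> \<in> space M. \<exists>S\<subseteq>{..<n}. card S = j \<and> clique a r (\<lambda>i. X i \<omega>) S}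
    \<longrightarrow> \<omega> \<in> (\<Union>t\<in>?T. ?F t)"
    using AE_torus
  proof eventually_elim
    case (elim \<omega>)
    show ?case
    proof safe
      fix S assume S: "\<omega> \<in> space M" "S \<subseteq> {..<n}" "clique a r (\<lambda>i. X i \<omega>) S" "j = card S"
      \<comment> \<open>\<open>j \<ge> 1\<close> supplies a point whose cell serves as
        \<open>c\<close>.\<close>
      then obtain i0 where i0: "i0 \<in> S" using j by fastforce
      define c where "c = (\<lambda>k. \<lfloor>X i0 \<omega> $ k / (a / real m)\<rfloor>)"
      have "c \<in> cells m" unfolding c_def using elim i0 S
        by (intro torus_mem_cells[OF a_pos m]) auto
      moreover have "X i \<omega> \<in> block m c" if "i \<in> S" for i
        unfolding c_def using that i0 S elim r
        by (intro mem_block m) (force simp: clique_def)+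
      ultimately show "\<omega> \<in> (\<Union>t\<in>cells m \<times> {T. T \<subseteq> {..<n} \<and> card T = card S}. ?F t)" using S by auto
    qed
  qed
  hence "prob {\<omega> \<in> space M. \<exists>S\<subseteq>{..<n}. card S = j \<and> clique a r (\<lambda>i. X i \<omega>) S} \<le> prob (\<Union>t\<in>?T. ?F t)"
    using F fin by (intro finite_measure_mono_AE sets.finite_UN) auto
  also have "\<dots> \<le> (\<Sum>t\<in>?T. prob (?F t))"
    using F fin by (intro finite_measure_subadditive_finite) auto
  also have "\<dots> \<le> (\<Sum>t\<in>?T. ?q ^ j)"
  proof (rule sum_mono)
    fix t assume "t \<in> ?T"
    then obtain c S where t: "t = (c, S)" "S \<subseteq> {..<n}" "card S = j" by auto
    have "prob (?F t) = (\<Prod>i\<in>S. prob {\<omega> \<in> space M. X i \<omega> \<in> block m c})"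
      unfolding t by (simp, intro prob_all) (use t in \<open>auto simp: block_borel\<close>)
    also have "\<dots> \<le> (\<Prod>i\<in>S. ?q)" using t m by (intro prod_mono conjI prob_block_le) auto
    finally show "prob (?F t) \<le> ?q ^ j" using t by simp
  qed
  also have "\<dots> = real (m ^ CARD('d)) * real (n choose j) * ?q ^ j"
    by (simp add: card_cartesian_product card_cells n_subsets)
  finally show ?thesis .
qed

section \<open>The second moment bound for full cells\<close>

text \<open>Events \<open>A (c, S)\<close> with different cells are jointly at most as likely as
  independent ones, so only pairs sharing a cell contribute to \<open>D\<close>.\<close>

lemma prob_no_full_cube_le:
  fixes m j :: nat
  assumes m: "m \<ge> 1" and j: "j \<le> n"
  defines "N \<equiv> real (m ^ CARD('d))"
  shows "prob {\<omega> \<in> space M. \<forall>c\<in>cells m. \<forall>S. S \<subseteq> {..<n} \<and> card S = j \<longrightarrow>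
            (\<exists>i\<in>S. X i \<omega> \<notin> cube (a / real m) c)}
    \<le> 2 ^ j * (1 + 1 / N) ^ n / (N * real (n choose j) * (1 / N) ^ j)"
proof -
  define p where "p = 1 / N"
  define \<S> where "\<S> = {S. S \<subseteq> {..<n} \<and> card S = j}"
  define T where "T = (cells m :: ('d \<Rightarrow> int) set) \<times> \<S>"
  define A where "A = (\<lambda>(c, S). {\<omega> \<in> space M. \<forall>i\<in>S. X i \<omega> \<in> cube (a / real m) c})"
  define \<mu> where "\<mu> = N * real (n choose j) * p ^ j"
  define D where "D = \<mu> * (2 ^ j * (1 + p) ^ n)"
  have N: "N > 0" using m by (simp add: N_def)
  have p: "p > 0" using N by (simp add: p_def)
  have fS: "finite \<S>" by (simp add: \<S>_def)
  have fin: "finite T" unfolding T_def by (intro finite_cartesian_product finite_cells fS)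
  have prA: "prob (A (c, S)) = p ^ card S" if "c \<in> cells m" "S \<subseteq> {..<n}" for c S
    using prob_all_cube[OF that(2) m that(1)] by (simp add: A_def p_def N_def)
  have F: "A t \<in> events" if "t \<in> T" for t
  proof -
    obtain c S where t: "t = (c, S)" "S \<subseteq> {..<n}" using \<open>t \<in> T\<close> by (auto simp: T_def \<S>_def)
    have [measurable]: "finite S" "\<And>i. i \<in> S \<Longrightarrow> X i \<in> borel_measurable M"
      using t(2) finite_subset by auto
    show ?thesis unfolding t A_def by simp measurable
  qed
  have sumT: "(\<Sum>t\<in>T. p ^ j) = \<mu>"
    by (simp add: T_def \<mu>_def card_cartesian_product card_cells \<S>_def n_subsets N_def)
  have \<mu>: "\<mu> = (\<Sum>t\<in>T. prob (A t))"
    unfolding sumT[symmetric] by (intro sum.cong) (auto simp: T_def \<S>_def prA)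
  have \<mu>_pos: "\<mu> > 0" using N p j by (simp add: \<mu>_def)
  \<comment> \<open>One row of the double sum: the first term bounds the other cells, the second the
    cell of \<open>t\<close> itself.\<close>
  have row: "(\<Sum>t'\<in>T. prob (A t \<inter> A t')) \<le> p ^ j * \<mu> + p ^ j * (2 ^ j * (1 + p) ^ n)"
    if "t \<in> T" for t
  proof -
    obtain c S where t: "t = (c, S)" "S \<subseteq> {..<n}" "card S = j" "c \<in> cells m" "S \<in> \<S>"
      using \<open>t \<in> T\<close> by (auto simp: T_def \<S>_def)
    have finS: "finite S" using t finite_subset by blast
    \<comment> \<open>A shared point cannot lie in two cells, so the joint event is empty; disjoint
      index sets give independent events.\<close>
    have diff: "prob (A t \<inter> A (c', S')) \<le> p ^ j * p ^ j" if c': "c' \<in> cells m" "c' \<noteq> c" "S' \<in> \<S>" for c' S'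
    proof (cases "S \<inter> S' = {}")
      case False
      hence "A t \<inter> A (c', S') = {}"
        using cube_disjoint[OF c'(2), of "a / real m"] by (fastforce simp: t A_def)
      thus ?thesis using p by simp
    next
      case True
      have S': "S' \<subseteq> {..<n}" "card S' = j" "finite S'"
        using c'(3) finite_subset by (auto simp: \<S>_def)
      let ?B = "\<lambda>i. if i \<in> S then cube (a / real m) c else cube (a / real m) c'"
      have "A t \<inter> A (c', S') = {\<omega> \<in> space M. \<forall>i\<in>S \<union> S'. X i \<omega> \<in> ?B i}"
        using True by (auto simp: t A_def)
      also have "prob \<dots> = (\<Prod>i\<in>S \<union> S'. prob {\<omega> \<in> space M. X i \<omega> \<in> ?B i})"
        using t S' by (intro prob_all) (auto simp: cube_borel)
      also have "\<dots> = (\<Prod>i\<in>S \<union> S'. p)"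
        using t S' c' m by (intro prod.cong refl) (auto simp: prob_cube p_def N_def)
      also have "\<dots> = p ^ j * p ^ j"
        using True finS S' t by (simp add: card_Un_disjoint power_add)
      finally show ?thesis by simp
    qed
    \<comment> \<open>Within one cell, only the points of \<open>S'\<close> outside \<open>S\<close>
      cost a further factor \<open>p\<close>.\<close>
    have same: "prob (A t \<inter> A (c, S')) = p ^ j * p ^ card (S' - S)" if "S' \<in> \<S>" for S'
    proof -
      have S': "S' \<subseteq> {..<n}" "finite S'" using that finite_subset by (auto simp: \<S>_def)
      have "A t \<inter> A (c, S') = A (c, S \<union> S')" by (auto simp: t A_def)
      also have "prob \<dots> = p ^ card (S \<union> S')" using t S' by (intro prA) auto
      also have "S \<union> S' = S \<union> (S' - S)" by auto
      also have "card \<dots> = j + card (S' - S)"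
        using finS S' t by (subst card_Un_disjoint) auto
      finally show ?thesis by (simp add: power_add)
    qed
    have "(\<Sum>t'\<in>T. prob (A t \<inter> A t')) = (\<Sum>c'\<in>cells m. \<Sum>S'\<in>\<S>. prob (A t \<inter> A (c', S')))"
      unfolding T_def by (simp add: sum.cartesian_product)
    also have "\<dots> = (\<Sum>S'\<in>\<S>. prob (A t \<inter> A (c, S'))) +
        (\<Sum>c'\<in>cells m - {c}. \<Sum>S'\<in>\<S>. prob (A t \<inter> A (c', S')))"
      using t finite_cells by (intro sum.remove) auto
    also have "(\<Sum>S'\<in>\<S>. prob (A t \<inter> A (c, S'))) = p ^ j * (\<Sum>S'\<in>\<S>. p ^ card (S' - S))"
      by (simp add: same sum_distrib_left)
    also have "(\<Sum>S'\<in>\<S>. p ^ card (S' - S)) \<le> 2 ^ card S * (1 + p) ^ card {..<n}"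
      using t p by (intro sum_power_card_Diff_le) (auto simp: \<S>_def)
    also have "(\<Sum>c'\<in>cells m - {c}. \<Sum>S'\<in>\<S>. prob (A t \<inter> A (c', S')))
        \<le> (\<Sum>c'\<in>cells m - {c}. \<Sum>S'\<in>\<S>. p ^ j * p ^ j)"
      using diff by (intro sum_mono) auto
    \<comment> \<open>Putting the cell \<open>c\<close> back completes the sum to
      \<open>p ^ j * \<mu>\<close>.\<close>
    also have "\<dots> \<le> (\<Sum>c'\<in>(cells m :: ('d \<Rightarrow> int) set). \<Sum>S'\<in>\<S>. p ^ j * p ^ j)"
      using finite_cells p by (intro sum_mono2) (auto intro!: sum_nonneg)
    also have "\<dots> = p ^ j * (\<Sum>t\<in>T. p ^ j)"
      by (simp add: T_def card_cartesian_product)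
    finally show ?thesis using p t unfolding sumT by simp
  qed
  have "(\<Sum>t\<in>T. \<Sum>t'\<in>T. prob (A t \<inter> A t')) \<le> (\<Sum>t\<in>T. p ^ j * \<mu> + p ^ j * (2 ^ j * (1 + p) ^ n))"
    by (intro sum_mono row)
  also have "\<dots> = (\<Sum>t\<in>T. p ^ j) * \<mu> + (\<Sum>t\<in>T. p ^ j) * (2 ^ j * (1 + p) ^ n)"
    by (simp only: sum.distrib sum_distrib_right)
  also have "\<dots> = \<mu>\<^sup>2 + D" unfolding sumT by (simp add: D_def power2_eq_square)
  finally have "prob {\<omega> \<in> space M. \<forall>t\<in>T. \<omega> \<notin> A t} \<le> D / \<mu>\<^sup>2"
    by (intro prob_none_le[where A = A, OF fin F \<mu> \<mu>_pos])
  also have "D / \<mu>\<^sup>2 = 2 ^ j * (1 + p) ^ n / \<mu>"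
    using \<mu>_pos by (simp add: D_def power2_eq_square)
  also have "{\<omega> \<in> space M. \<forall>t\<in>T. \<omega> \<notin> A t} = {\<omega> \<in> space M. \<forall>c\<in>cells m. \<forall>S. S \<subseteq> {..<n} \<and> card S = j \<longrightarrow>
            (\<exists>i\<in>S. X i \<omega> \<notin> cube (a / real m) c)}"
    by (auto simp: T_def A_def \<S>_def)
  finally show ?thesis by (simp add: p_def \<mu>_def)
qed

text \<open>With cell side at most \<open>r\<close>, any \<open>j\<close> distinct points in one
  cell form a clique. Distinctness comes from \<open>AE_inj\<close>, so the inclusion of events
  holds up to a null set.\<close>

lemma prob_clique_ge:
  assumes m: "m \<ge> 1" and r: "a / real m \<le> r" and j: "j \<le> n"
  defines "N \<equiv> real (m ^ CARD('d))"
  shows "prob {\<omega> \<in> space M. \<exists>S\<subseteq>{..<n}. card S = j \<and> clique a r (\<lambda>i. X i \<omega>) S}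
    \<ge> 1 - 2 ^ j * (1 + 1 / N) ^ n / (N * real (n choose j) * (1 / N) ^ j)"
proof -
  let ?C = "{\<omega> \<in> space M. \<exists>S\<subseteq>{..<n}. card S = j \<and> clique a r (\<lambda>i. X i \<omega>) S}"
  let ?B = "{\<omega> \<in> space M. \<forall>c\<in>cells m. \<forall>S. S \<subseteq> {..<n} \<and> card S = j \<longrightarrow>
            (\<exists>i\<in>S. X i \<omega> \<notin> cube (a / real m) c)}"
  have "?B \<in> events"
  proof -
    have "{\<omega> \<in> space M. \<exists>i\<in>S. X i \<omega> \<notin> cube (a / real m) c} \<in> events" if "S \<subseteq> {..<n}" for S c
    proof -
      have [measurable]: "finite S" "\<And>i. i \<in> S \<Longrightarrow> X i \<in> borel_measurable M"
        using that finite_subset by auto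
      show ?thesis by measurable
    qed
    hence "{\<omega> \<in> space M. \<forall>c\<in>cells m. \<forall>S\<in>{S. S \<subseteq> {..<n} \<and> card S = j}.
            (\<exists>i\<in>S. X i \<omega> \<notin> cube (a / real m) c)} \<in> events"
      using finite_cells by (intro sets.sets_Collect_finite_All) auto
    thus ?thesis by simp
  qed
  have "prob (space M - ?C) \<le> prob ?B"
  proof (rule finite_measure_mono_AE)
    show "AE \<omega> in M. \<omega> \<in> space M - ?C \<longrightarrow> \<omega> \<in> ?B"
      using AE_inj
    proof eventually_elim
      case (elim \<omega>)
      have "clique a r (\<lambda>i. X i \<omega>) S"
        if S: "S \<subseteq> {..<n}" "\<And>i. i \<in> S \<Longrightarrow> X i \<omega> \<in> cube (a / real m) c" for S c
        unfolding clique_def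
      proof (intro conjI ballI)
        fix i l assume "i \<in> S" "l \<in> S"
        hence "torus_dist a (X i \<omega>) (X l \<omega>) \<le> a / real m"
          using S a_pos m by (intro torus_dist_same_cube[of _ _ c]) auto
        thus "torus_dist a (X i \<omega>) (X l \<omega>) \<le> r" using r by linarith
      qed (use elim S inj_on_subset in blast)
      thus ?case by blast
    qed
  qed fact
  thus ?thesis using prob_no_full_cube_le[OF m j] prob_compl[OF clique_event[of j r]]
    unfolding N_def by linarith
qed

end

section \<open>Asymptotics of the two bounds and choice of the grids\<close>

text \<open>Terms of the exponential series vanish in the limit, and their index tends to infinity
  with \<open>n\<close>.\<close>

lemma clique_bound_tendsto_0:
  fixes B \<beta> :: real
  shows "(\<lambda>n. \<beta> * ((exp 1 * B) ^ (nat \<lceil>ln (real n)\<rceil> + 1) / fact (nat \<lceil>ln (real n)\<rceil> + 1))) \<longlonglongrightarrow> 0"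
proof -
  have "(\<lambda>j. (exp 1 * B) ^ j / fact j :: real) \<longlonglongrightarrow> 0"
    using summable_LIMSEQ_zero[OF summable_exp[of "exp 1 * B"]] by (simp add: field_simps)
  moreover have "filterlim (\<lambda>n. nat \<lceil>ln (real n)\<rceil> + 1) at_top sequentially" by real_asymp
  ultimately show ?thesis by (intro tendsto_mult_right_zero) (rule filterlim_compose)
qed

text \<open>From \<open>n choose j \<le> n ^ j / fact j\<close> and \<open>N\<close> of order
  \<open>n\<close>: all powers of \<open>n\<close> cancel except the factor from the number of
  cells, which \<open>ln n \<le> j\<close> bounds by \<open>exp 1 ^ j\<close>.\<close>

lemma many_cliques_bound:
  fixes N B \<alpha> \<beta> :: real and n j :: nat
  assumes n: "n \<ge> 1" and N: "\<alpha> * real n \<le> N" "N \<le> \<beta> * real n" and \<alpha>: "\<alpha> > 0" and B: "B \<ge> 0"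
    and j: "ln (real n) \<le> real j"
  shows "N * real (n choose j) * (B / N) ^ j \<le> \<beta> * ((exp 1 * (B / \<alpha>)) ^ j / fact j)"
proof -
  have n0: "real n > 0" using n by simp
  have "\<alpha> * real n > 0" using n0 \<alpha> by simp
  hence N0: "N > 0" using N by linarith
  have \<beta>: "\<beta> \<ge> 0" using N N0 n0 by (smt (verit) mult_nonpos_nonneg)
  have "real (n choose j) * fact j \<le> real n ^ j"
    using binomial_fact_pow[of n j] by (metis of_nat_fact of_nat_le_iff of_nat_mult of_nat_power)
  hence C: "real (n choose j) \<le> real n ^ j / fact j" by (simp add: field_simps)
  have "(B / N) ^ j \<le> (B / (\<alpha> * real n)) ^ j"
    using N \<alpha> n0 N0 B by (intro power_mono divide_left_mono) auto
  with C N have "N * real (n choose j) * (B / N) ^ j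
      \<le> (\<beta> * real n) * (real n ^ j / fact j) * (B / (\<alpha> * real n)) ^ j"
    using N0 B \<beta> by (intro mult_mono) auto
  also have "\<dots> = real n * (\<beta> * ((B / \<alpha>) ^ j / fact j))"
    using n0 by (simp add: power_divide power_mult_distrib mult_ac)
  also have "real n \<le> exp 1 ^ j"
    using j n0 by (simp add: exp_of_nat_mult[symmetric] ln_ge_iff[symmetric] ln_le_cancel_iff[symmetric] del: ln_le_cancel_iff)
  hence "real n * (\<beta> * ((B / \<alpha>) ^ j / fact j)) \<le> exp 1 ^ j * (\<beta> * ((B / \<alpha>) ^ j / fact j))"
    using \<beta> B \<alpha> by (intro mult_right_mono) auto
  also have "\<dots> = \<beta> * ((exp 1 * (B / \<alpha>)) ^ j / fact j)"
    by (simp only: power_mult_distrib) simp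
  finally show ?thesis .
qed

text \<open>By \<open>(n / j) ^ j \<le> n choose j\<close>, the expected count in the denominator is
  at least \<open>\<alpha> * n / (\<beta> * j) ^ j\<close>, while \<open>(1 + 1 / N) ^ n\<close>
  stays bounded. The real \<open>x\<close> above \<open>j\<close> gives a closed form whose limit
  can be computed.\<close>

lemma second_moment_bound:
  fixes N \<alpha> \<beta> x :: real and n j :: nat
  assumes n: "n \<ge> 1" and N: "\<alpha> * real n \<le> N" "N \<le> \<beta> * real n" and \<alpha>: "\<alpha> > 0" and \<beta>: "\<beta> \<ge> 1"
    and j: "1 \<le> j" "real j \<le> x" "j \<le> n"
  shows "2 ^ j * (1 + 1 / N) ^ n / (N * real (n choose j) * (1 / N) ^ j)
    \<le> exp (1 / \<alpha>) / \<alpha> * ((2 * \<beta> * x) powr x / real n)"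
proof -
  have n0: "real n > 0" using n by simp
  have an: "\<alpha> * real n > 0" using n0 \<alpha> by simp
  hence N0: "N > 0" using N by linarith
  have j0: "real j > 0" using j by simp
  have "(1 + 1 / N) ^ n \<le> exp (1 / N) ^ n"
    using N0 exp_ge_add_one_self[of "1 / N"] by (intro power_mono) auto
  also have "\<dots> = exp (real n / N)" by (simp add: exp_of_nat_mult[symmetric])
  also have "real n / N \<le> 1 / \<alpha>" using N N0 \<alpha> by (simp add: field_simps)
  finally have e: "(1 + 1 / N) ^ n \<le> exp (1 / \<alpha>)" by simp
  have "(1 / (real j * \<beta>)) ^ j \<le> (real n / (real j * N)) ^ j"
    using N N0 n0 j0 \<beta> by (intro power_mono) (auto simp: field_simps)
  also have "\<dots> = (real n / real j) ^ j * (1 / N) ^ j"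
    by (simp add: power_divide power_mult_distrib)
  also have "\<dots> \<le> real (n choose j) * (1 / N) ^ j"
    using binomial_ge_n_over_k_pow_k[OF j(3), where ?'a = real] N0 by (intro mult_right_mono) auto
  finally have C: "(1 / (real j * \<beta>)) ^ j \<le> real (n choose j) * (1 / N) ^ j" .
  have den: "\<alpha> * real n * (1 / (real j * \<beta>)) ^ j \<le> N * (real (n choose j) * (1 / N) ^ j)"
    using C N N0 an j0 \<beta> by (intro mult_mono) auto
  have "2 ^ j * (1 + 1 / N) ^ n / (N * real (n choose j) * (1 / N) ^ j)
      \<le> 2 ^ j * exp (1 / \<alpha>) / (\<alpha> * real n * (1 / (real j * \<beta>)) ^ j)"
    unfolding mult.assoc[of N] using e den an j0 \<beta> N0 by (intro frac_le mult_left_mono) auto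
  also have "\<dots> = exp (1 / \<alpha>) / \<alpha> * ((2 * \<beta> * real j) ^ j / real n)"
    using an j0 \<beta> by (simp add: power_divide power_mult_distrib field_simps)
  \<comment> \<open>Raising the exponent to \<open>x\<close> needs a base of at least
    \<open>1\<close>.\<close>
  also have "(2 * \<beta> * real j) ^ j \<le> (2 * \<beta> * x) powr x"
  proof -
    have "1 * 1 \<le> \<beta> * x" using \<beta> j by (intro mult_mono) auto
    hence "1 \<le> 2 * \<beta> * x" by simp
    hence "(2 * \<beta> * x) powr real j \<le> (2 * \<beta> * x) powr x" using j by (intro powr_mono) auto
    moreover have "(2 * \<beta> * real j) ^ j \<le> (2 * \<beta> * x) ^ j"
      using j \<beta> by (intro power_mono mult_left_mono) auto
    moreover have "(2 * \<beta> * x) powr real j = (2 * \<beta> * x) ^ j"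
      using \<open>1 \<le> 2 * \<beta> * x\<close> by (intro powr_realpow) auto
    ultimately show ?thesis by linarith
  qed
  finally show ?thesis using \<alpha> n0 by (simp add: divide_right_mono mult_left_mono)
qed

text \<open>Applied with \<open>q = a / r\<close> and \<open>\<nu> = n\<close>: \<open>m\<close>
  gives cells of side above \<open>r\<close>, \<open>m'\<close> cells of side at most
  \<open>r\<close>. Since \<open>q \<ge> 2\<close>, both are within a factor \<open>2\<close> of
  \<open>q\<close>, which costs \<open>2 ^ d\<close> in the number of cells.\<close>

lemma exists_fine_coarse_grid:
  fixes q \<alpha> \<beta> \<nu> :: real and d :: nat
  assumes q: "q \<ge> 2" and lo: "\<alpha> * \<nu> \<le> q ^ d" and hi: "q ^ d \<le> \<beta> * \<nu>" and \<alpha>: "\<alpha> * \<nu> \<ge> 0" "\<beta> * \<nu> \<ge> 0"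
  obtains m m' :: nat where "m \<ge> 1" "m' \<ge> 1" "real m < q" "q \<le> real m'"
    "\<alpha> / 2 ^ d * \<nu> \<le> real (m ^ d)" "real (m ^ d) \<le> 2 ^ d * \<beta> * \<nu>"
    "\<alpha> / 2 ^ d * \<nu> \<le> real (m' ^ d)" "real (m' ^ d) \<le> 2 ^ d * \<beta> * \<nu>"
proof
  define m' where "m' = nat \<lceil>q\<rceil>"
  \<comment> \<open>\<open>\<lceil>q\<rceil> - 1\<close> rather than
    \<open>\<lfloor>q\<rfloor>\<close>, to stay strictly below \<open>q\<close> when
    \<open>q\<close> is an integer.\<close>
  define m where "m = m' - 1"
  have m': "q \<le> real m'" "real m' < q + 1" using q unfolding m'_def by linarith+
  have m: "real m = real m' - 1" using m' q by (auto simp: m_def)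
  show "m \<ge> 1" "m' \<ge> 1" "real m < q" "q \<le> real m'" using m m' q by linarith+
  have b: "\<alpha> / 2 ^ d * \<nu> \<le> real (k ^ d) \<and> real (k ^ d) \<le> 2 ^ d * \<beta> * \<nu>"
    if "q / 2 \<le> real k" "real k \<le> 2 * q" for k
  proof
    have "\<alpha> / 2 ^ d * \<nu> \<le> (q / 2) ^ d" using lo by (simp add: power_divide divide_right_mono)
    also have "\<dots> \<le> real (k ^ d)" using that q by (auto intro: power_mono)
    finally show "\<alpha> / 2 ^ d * \<nu> \<le> real (k ^ d)" .
    have "real (k ^ d) \<le> (2 * q) ^ d" using that power_mono[of "real k" "2 * q" d] by simp
    also have "\<dots> \<le> 2 ^ d * \<beta> * \<nu>" using hi by (simp add: power_mult_distrib)
    finally show "real (k ^ d) \<le> 2 ^ d * \<beta> * \<nu>" .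
  qed
  show "\<alpha> / 2 ^ d * \<nu> \<le> real (m ^ d)" "real (m ^ d) \<le> 2 ^ d * \<beta> * \<nu>"
    using b[of m] m m' q by linarith+
  show "\<alpha> / 2 ^ d * \<nu> \<le> real (m' ^ d)" "real (m' ^ d) \<le> 2 ^ d * \<beta> * \<nu>"
    using b[of m'] m m' q by linarith+
qed

section \<open>The critical regime: bounds on \<open>K\<close> and passage to the limit\<close>

theorem theorem13:
  fixes M :: "nat \<Rightarrow> 'w measure"
    and X :: "nat \<Rightarrow> nat \<Rightarrow> 'w \<Rightarrow> real ^ 'd"
    and a r \<theta> :: "nat \<Rightarrow> real"
    and \<eta> :: real
  assumes a_pos: "\<And>n. n \<ge> 1 \<Longrightarrow> a n > 0"
    and r_nonneg: "\<And>n. n \<ge> 1 \<Longrightarrow> r n \<ge> 0"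
    and theta: "\<And>n. n \<ge> 1 \<Longrightarrow> \<theta> n = (r n / a n) ^ CARD('d)"
    and theta_le: "\<And>n. n \<ge> 1 \<Longrightarrow> \<theta> n \<le> (1 / 2) ^ CARD('d)"
    and critical: "\<theta> \<in> \<Theta>(\<lambda>n. 1 / real n)"
    and points: "\<And>n. n \<ge> 1 \<Longrightarrow> binomial_points (M n) n (a n) (X n)"
    and eta: "\<eta> > 0"
  shows "(\<lambda>n. \<P>(\<omega> in M n.
            ln (real n) powr (1 - \<eta>)
              < real (complex_dim (vietoris_rips (a n) (r n) ((\<lambda>i. X n i \<omega>) ` {..<n}))) \<and>
            real (complex_dim (vietoris_rips (a n) (r n) ((\<lambda>i. X n i \<omega>) ` {..<n})))
              < ln (real n)))
         \<longlonglongrightarrow> 1"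
proof -
  define K where "K n \<omega> = complex_dim (vietoris_rips (a n) (r n) ((\<lambda>i. X n i \<omega>) ` {..<n}))" for n \<omega>
  let ?d = "CARD('d)"
  obtain c where c: "c > 0" "eventually (\<lambda>n. norm (\<theta> n) \<le> c * norm (1 / real n)) sequentially"
    using bigthetaD1[OF critical] by (rule landau_o.bigE)
  obtain c' where c': "c' > 0" "eventually (\<lambda>n. norm (\<theta> n) \<ge> c' * norm (1 / real n)) sequentially"
    using bigthetaD2[OF critical] by (rule landau_omega.bigE)
  \<comment> \<open>Both grids will have between \<open>\<alpha> * n\<close> and
    \<open>\<beta> * n\<close> cells, because \<open>1 / \<theta> n\<close> lies between
    \<open>n / c\<close> and \<open>n / c'\<close>. The maximum with \<open>1\<close> serves
    \<open>second_moment_bound\<close>.\<close>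
  define \<alpha> where "\<alpha> = 1 / c / 2 ^ ?d"
  define \<beta> where "\<beta> = max 1 (2 ^ ?d * (1 / c'))"
  define B where "B = (3 :: real) ^ ?d"
  \<comment> \<open>Capping \<open>\<eta>\<close> at \<open>1 / 2\<close> keeps the exponent
    strictly between \<open>0\<close> and \<open>1\<close> for large \<open>\<eta>\<close> as well;
    a larger exponent only strengthens the lower bound.\<close>
  define \<delta> where "\<delta> = 1 - min \<eta> (1 / 2)"
  have \<delta>: "0 < \<delta>" "\<delta> < 1" "1 - \<eta> \<le> \<delta>" using eta by (auto simp: \<delta>_def)
  have \<alpha>: "\<alpha> > 0" and \<beta>: "\<beta> \<ge> 1" and B: "B \<ge> 0" using c c' by (auto simp: \<alpha>_def \<beta>_def B_def)
  \<comment> \<open>The \<open>+ 2\<close> makes \<open>x n\<close> a bound for the clique size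
    \<open>k1 + 1\<close> below. Then \<open>f n\<close> bounds the failure probability of the lower
    bound on \<open>K\<close>, and \<open>g n\<close> that of the upper bound.\<close>
  define x where "x n = ln (real n) powr \<delta> + 2" for n
  define f where "f n = exp (1 / \<alpha>) / \<alpha> * ((2 * \<beta> * x n) powr x n / real n)" for n
  define g where "g n = \<beta> * ((exp 1 * (B / \<alpha>)) ^ (nat \<lceil>ln (real n)\<rceil> + 1) / fact (nat \<lceil>ln (real n)\<rceil> + 1))"
    for n
  \<comment> \<open>The logarithm of the numerator is of order
    \<open>ln n powr \<delta> * ln (ln n)\<close>, hence \<open>o(ln n)\<close> as
    \<open>\<delta> < 1\<close>.\<close>
  have "(\<lambda>n. (\<gamma> * (ln (real n) powr \<delta> + 2)) powr (ln (real n) powr \<delta> + 2) / real n) \<longlonglongrightarrow> 0"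
    if "\<gamma> > 0" for \<gamma> :: real
    using \<delta>(1,2) that by real_asymp
  from this[of "2 * \<beta>"] have f: "f \<longlonglongrightarrow> 0"
    unfolding f_def x_def using \<beta> by (intro tendsto_mult_right_zero) auto
  have g: "g \<longlonglongrightarrow> 0" unfolding g_def by (rule clique_bound_tendsto_0)
  have "eventually (\<lambda>n. ln (real n) powr \<delta> + 2 \<le> real n) sequentially"
    using \<delta>(1,2) by real_asymp
  hence "eventually (\<lambda>n. x n \<le> real n) sequentially" by (simp add: x_def)
  moreover have "eventually (\<lambda>n. 1 \<le> ln (real n)) sequentially" by real_asymp
  ultimately have bounds: "eventually (\<lambda>n. 1 - f n - g n \<le>
      \<P>(\<omega> in M n. ln (real n) powr (1 - \<eta>) < real (K n \<omega>) \<and> real (K n \<omega>) < ln (real n)) \<and>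
      \<P>(\<omega> in M n. ln (real n) powr (1 - \<eta>) < real (K n \<omega>) \<and> real (K n \<omega>) < ln (real n)) \<le> 1) sequentially"
    using c(2) c'(2) eventually_ge_at_top[of 1]
  proof eventually_elim
    case (elim n)
    note n = \<open>1 \<le> n\<close>
    note an = a_pos[OF n]
    interpret torus_process "M n" n "a n" "X n"
      using points[OF n] an
      by (auto simp: binomial_points_def torus_process_def torus_process_axioms_def)
    define q where "q = a n / r n"
    have \<theta>: "\<theta> n > 0" "\<theta> n \<le> c / real n" "c' / real n \<le> \<theta> n"
    proof -
      have "\<theta> n \<ge> 0" using theta[OF n] r_nonneg[OF n] an by simp
      with elim n show "\<theta> n \<le> c / real n" "c' / real n \<le> \<theta> n" by auto
      moreover have "c' / real n > 0" using c' n by simp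
      ultimately show "\<theta> n > 0" by linarith
    qed
    \<comment> \<open>A zero radius would make \<open>\<theta> n\<close> zero, as the dimension is
      positive.\<close>
    have r: "r n > 0"
      using \<theta>(1) theta[OF n] r_nonneg[OF n] by (cases "r n = 0") (auto simp: zero_power)
    have q\<theta>: "q ^ ?d = 1 / \<theta> n" using theta[OF n] by (simp add: q_def power_divide)
    have "r n / a n \<le> 1 / 2"
      using theta_le[OF n] theta[OF n] r an
      by (metis half_gt_zero_iff less_eq_real_def power_mono_iff zero_less_card_finite
          zero_less_divide_iff zero_less_one)
    hence q2: "q \<ge> 2" using r an by (simp add: q_def field_simps)
    have "1 / c * real n \<le> q ^ ?d" "q ^ ?d \<le> 1 / c' * real n"
      using \<theta> c(1) c'(1) n unfolding q\<theta> by (auto simp: field_simps)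
    then obtain m m' :: nat where mm: "m \<ge> 1" "m' \<ge> 1" "real m < q" "q \<le> real m'"
      "\<alpha> * real n \<le> real (m ^ ?d)" "real (m ^ ?d) \<le> 2 ^ ?d * (1 / c') * real n"
      "\<alpha> * real n \<le> real (m' ^ ?d)" "real (m' ^ ?d) \<le> 2 ^ ?d * (1 / c') * real n"
      using exists_fine_coarse_grid[OF q2, of "1 / c" "real n" ?d "1 / c'"] c(1) c'(1)
      unfolding \<alpha>_def by (metis divide_nonneg_pos mult_nonneg_nonneg of_nat_0_le_iff zero_le_one)
    have m'r: "a n / real m' \<le> r n"
      using mm(2,4) r by (simp add: q_def divide_le_eq mult.commute)
    have "2 ^ ?d * (1 / c') * real n \<le> \<beta> * real n"
      unfolding \<beta>_def by (intro mult_right_mono) auto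
    with mm have m\<beta>: "real (m ^ ?d) \<le> \<beta> * real n" "real (m' ^ ?d) \<le> \<beta> * real n" by linarith+
    \<comment> \<open>\<open>k1\<close> is the least natural number strictly above the lower bound,
      \<open>k2\<close> the least one not below \<open>ln n\<close>. A simplex of dimension
      \<open>k\<close> has \<open>k + 1\<close> vertices, hence the shift in
      \<open>?E\<close>.\<close>
    define k1 where "k1 = nat \<lfloor>ln (real n) powr (1 - \<eta>)\<rfloor> + 1"
    define k2 where "k2 = nat \<lceil>ln (real n)\<rceil>"
    let ?E = "\<lambda>k. {\<omega> \<in> space (M n). \<exists>S\<subseteq>{..<n}. card S = k + 1 \<and> clique (a n) (r n) (\<lambda>i. X n i \<omega>) S}"
    have K: "k \<le> K n \<omega> \<longleftrightarrow> (\<exists>S\<subseteq>{..<n}. card S = k + 1 \<and> clique (a n) (r n) (\<lambda>i. X n i \<omega>) S)" for k \<omega>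
      unfolding K_def using n r by (intro le_complex_dim_iff) auto
    have K1: "ln (real n) powr (1 - \<eta>) < real (K n \<omega>) \<longleftrightarrow> k1 \<le> K n \<omega>" for \<omega>
    proof -
      have "ln (real n) powr (1 - \<eta>) \<ge> 0" by simp
      thus ?thesis unfolding k1_def by linarith
    qed
    have K2: "real (K n \<omega>) < ln (real n) \<longleftrightarrow> \<not> k2 \<le> K n \<omega>" for \<omega>
      unfolding k2_def using elim by linarith
    have "\<P>(\<omega> in M n. ln (real n) powr (1 - \<eta>) < real (K n \<omega>) \<and> real (K n \<omega>) < ln (real n)) =
        prob (?E k1 - ?E k2)"
      unfolding K1 K2 K by (intro arg_cong[where f = prob]) auto
    moreover have "prob (?E k1 - ?E k2) \<ge> prob (?E k1) - prob (?E k2)"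
    proof -
      have "prob (?E k1) \<le> prob ((?E k1 - ?E k2) \<union> ?E k2)"
        using clique_event by (intro finite_measure_mono sets.Un sets.Diff) auto
      also have "\<dots> \<le> prob (?E k1 - ?E k2) + prob (?E k2)"
        using clique_event by (intro measure_Un_le sets.Diff)
      finally show ?thesis by linarith
    qed
    moreover have "prob (?E k2) \<le> g n"
    proof -
      \<comment> \<open>The coarse grid: \<open>m < q\<close> makes the cell side exceed
        \<open>r n\<close>.\<close>
      have "prob (?E k2) \<le> real (m ^ ?d) * real (n choose (k2 + 1)) * (B / real (m ^ ?d)) ^ (k2 + 1)"
        unfolding B_def using mm r by (intro prob_clique_le) (auto simp: q_def field_simps)
      also have "\<dots> \<le> g n"
        unfolding g_def k2_def[symmetric]
        using n mm m\<beta> \<alpha> B by (intro many_cliques_bound) (auto simp: k2_def, linarith)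
      finally show ?thesis .
    qed
    moreover have "prob (?E k1) \<ge> 1 - f n"
    proof -
      have "ln (real n) powr (1 - \<eta>) \<le> ln (real n) powr \<delta>"
        using elim \<delta> by (intro powr_mono) auto
      moreover have "real (nat \<lfloor>ln (real n) powr (1 - \<eta>)\<rfloor>) \<le> ln (real n) powr (1 - \<eta>)" by simp
      ultimately have kx: "real (k1 + 1) \<le> x n" unfolding k1_def x_def by linarith
      hence kn: "k1 + 1 \<le> n" using elim by linarith
      \<comment> \<open>The fine grid, with cell side at most \<open>r n\<close>.\<close>
      let ?N = "real (m' ^ ?d)"
      have "prob (?E k1) \<ge> 1 - 2 ^ (k1 + 1) * (1 + 1 / ?N) ^ n / (?N * real (n choose (k1 + 1)) * (1 / ?N) ^ (k1 + 1))"
        by (rule prob_clique_ge[OF mm(2) m'r kn])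
      moreover have "2 ^ (k1 + 1) * (1 + 1 / ?N) ^ n / (?N * real (n choose (k1 + 1)) * (1 / ?N) ^ (k1 + 1)) \<le> f n"
        unfolding f_def using n mm m\<beta> \<alpha> \<beta> kx kn by (intro second_moment_bound) auto
      ultimately show ?thesis by linarith
    qed
    ultimately show ?case by (intro conjI prob_le_1) linarith
  qed
  have lim: "(\<lambda>n. 1 - f n - g n) \<longlonglongrightarrow> 1"
    using tendsto_diff[OF tendsto_diff[OF tendsto_const[of 1] f] g] by simp
  show ?thesis
    unfolding K_def[symmetric]
    by (rule tendsto_sandwich[OF bounds[THEN eventually_conj_iff[THEN iffD1], THEN conjunct1]
          bounds[THEN eventually_conj_iff[THEN iffD1], THEN conjunct2] lim tendsto_const])
qed

end
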